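(* Let $f(t)=\sum_{m=0}^{\infty}a_m t^m$ be a formal power series with complex coefficients, and let $x,z$ be indeterminates; all identities below are identities of formal power series in $x,z$. Consider the three identities (BE) $\displaystyle\sum_{n=0}^{\infty}\frac{x^n}{n!}\left\{\sum_{k=0}^n\binom{n}{k}(-1)^k f(zk)\right\}=\sum_{m=0}^{\infty}a_m z^m\varphi_m(-x)$; (ES) $\displaystyle\sum_{n=0}^{\infty}\frac{x^n}{n!}f(zn)=e^x\sum_{m=0}^{\infty}a_m z^m\varphi_m(x)$; (EE) $\displaystyle e^x\sum_{n=0}^{\infty}\frac{(-x)^n}{n!}f(zn)=\sum_{n=0}^{\infty}\frac{x^n}{n!}\left\{\sum_{k=0}^n\binom{n}{k}(-1)^k f(zk)\right\}$. Then any two of (BE), (ES), (EE) together imply the third. Likewise, consider the three identities (BG) $\displaystyle\sum_{n=0}^{\infty}x^n\left\{\sum_{k=0}^n\binom{n}{k}(-1)^k f(zk)\right\}=\sum_{m=0}^{\infty}a_m z^m\omega_m(-x)$; (GS) $\displaystyle\sum_{n=0}^{\infty}x^n f(zn)=\frac{1}{1-x}\sum_{m=0}^{\infty}a_m z^m\omega_m\!\left(\frac{x}{1-x}\right)$; (EG) $\displaystyle\frac{1}{1-x}\sum_{n=0}^{\infty}(-1)^n f(zn)\left(\frac{x}{1-x}\right)^n=\sum_{n=0}^{\infty}x^n\left\{\sum_{k=0}^n\binom{n}{k}(-1)^k f(zk)\right\}$. Then any two of (BG), (GS), (EG) together imply the third.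
   Context: $S(m,n)$ denotes the Stirling numbers of the second kind, $S(m,n)=\frac{(-1)^n}{n!}\sum_{k=0}^n\binom{n}{k}(-1)^k k^m$. The exponential polynomials are $\varphi_m(x)=\sum_{n=0}^m S(m,n)x^n$ and the geometric polynomials are $\omega_m(x)=\sum_{n=0}^m S(m,n)\,n!\,x^n$. *)

theory Defs
  imports
    "HOL-Computational_Algebra.Computational_Algebra"
    "HOL-Combinatorics.Stirling"
begin

text \<open>
  The ring of formal power series in \<open>x\<close> and \<open>z\<close> over the complex numbers is represented as
  \<open>complex fps fps\<close>: the outer variable is \<open>z\<close> and the coefficients are series in \<open>x\<close>.
  Thus \<open>F $ i $ j\<close> is the coefficient of \<open>z\<^sup>i x\<^sup>j\<close>.
\<close>

type_synonym xzseries = "complex fps fps"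

abbreviation xz_const :: "complex \<Rightarrow> xzseries" where
  "xz_const c \<equiv> fps_const (fps_const c)"

abbreviation of_xseries :: "complex fps \<Rightarrow> xzseries" where
  "of_xseries g \<equiv> fps_const g"

definition zvar :: xzseries where
  "zvar = fps_X"

definition xvar :: xzseries where
  "xvar = of_xseries fps_X"

definition xexp :: xzseries where  \<comment> \<open>\<open>e\<^sup>x\<close>\<close>
  "xexp = of_xseries (fps_exp 1)"

definition xgeo :: xzseries where  \<comment> \<open>\<open>1 / (1 - x)\<close>\<close>
  "xgeo = of_xseries (1 / (1 - fps_X))"

definition xfrac :: xzseries where  \<comment> \<open>\<open>x / (1 - x)\<close>\<close>
  "xfrac = of_xseries (fps_X / (1 - fps_X))"

text \<open>
  Infinite sums of series in \<open>x, z\<close>, taken coefficient by coefficient: the family is summable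
  if every monomial \<open>z\<^sup>i x\<^sup>j\<close> occurs in only finitely many members.  The topology that the library
  puts on \<open>complex fps fps\<close> is not used, since it treats the coefficients (series in \<open>x\<close>) as
  discrete, so that sums over powers of \<open>x\<close> do not converge in it.
\<close>

definition xz_summable :: "(nat \<Rightarrow> xzseries) \<Rightarrow> bool" where
  "xz_summable F \<longleftrightarrow> (\<forall>i j. finite {n. F n $ i $ j \<noteq> 0})"

definition xz_suminf :: "(nat \<Rightarrow> xzseries) \<Rightarrow> xzseries" where
  "xz_suminf F = Abs_fps (\<lambda>i. Abs_fps (\<lambda>j. \<Sum>n | F n $ i $ j \<noteq> 0. F n $ i $ j))"

definition at_zmult :: "complex fps \<Rightarrow> nat \<Rightarrow> xzseries" where  \<comment> \<open>\<open>f(zk)\<close>\<close>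
  "at_zmult f k = Abs_fps (\<lambda>m. fps_const (f $ m)) oo (of_nat k * zvar)"

text \<open>
  The exponential and geometric polynomials have natural number coefficients; they are kept
  polymorphic so that they can be evaluated in the ring of series.
\<close>

definition exp_poly :: "nat \<Rightarrow> 'a::comm_semiring_1 poly" where
  "exp_poly m = (\<Sum>n\<le>m. monom (of_nat (Stirling m n)) n)"

definition geo_poly :: "nat \<Rightarrow> 'a::comm_semiring_1 poly" where
  "geo_poly m = (\<Sum>n\<le>m. monom (of_nat (Stirling m n * fact n)) n)"

definition binom_diff :: "complex fps \<Rightarrow> nat \<Rightarrow> xzseries" where
  "binom_diff f n = (\<Sum>k\<le>n. of_nat (n choose k) * (- 1) ^ k * at_zmult f k)"

definition BE :: "complex fps \<Rightarrow> bool" where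
  "BE f \<longleftrightarrow>
     xz_suminf (\<lambda>n. xz_const (1 / fact n) * xvar ^ n * binom_diff f n)
     = xz_suminf (\<lambda>m. xz_const (f $ m) * zvar ^ m * poly (exp_poly m) (- xvar))"

definition ES :: "complex fps \<Rightarrow> bool" where
  "ES f \<longleftrightarrow>
     xz_suminf (\<lambda>n. xz_const (1 / fact n) * xvar ^ n * at_zmult f n)
     = xexp * xz_suminf (\<lambda>m. xz_const (f $ m) * zvar ^ m * poly (exp_poly m) xvar)"

definition EE :: "complex fps \<Rightarrow> bool" where
  "EE f \<longleftrightarrow>
     xexp * xz_suminf (\<lambda>n. xz_const (1 / fact n) * (- xvar) ^ n * at_zmult f n)
     = xz_suminf (\<lambda>n. xz_const (1 / fact n) * xvar ^ n * binom_diff f n)"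

definition BG :: "complex fps \<Rightarrow> bool" where
  "BG f \<longleftrightarrow>
     xz_suminf (\<lambda>n. xvar ^ n * binom_diff f n)
     = xz_suminf (\<lambda>m. xz_const (f $ m) * zvar ^ m * poly (geo_poly m) (- xvar))"

definition GS :: "complex fps \<Rightarrow> bool" where
  "GS f \<longleftrightarrow>
     xz_suminf (\<lambda>n. xvar ^ n * at_zmult f n)
     = xgeo * xz_suminf (\<lambda>m. xz_const (f $ m) * zvar ^ m * poly (geo_poly m) xfrac)"

definition EG :: "complex fps \<Rightarrow> bool" where
  "EG f \<longleftrightarrow>
     xgeo * xz_suminf (\<lambda>n. (- 1) ^ n * at_zmult f n * xfrac ^ n)
     = xz_suminf (\<lambda>n. xvar ^ n * binom_diff f n)"

subsection \<open>Consistency of the definitions\<close>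

lemma alternating_sum_Stirling:
  "(\<Sum>k\<le>n. of_nat (n choose k) * (- 1) ^ k * of_nat k ^ m) =
     ((- 1) ^ n * fact n * of_nat (Stirling m n) :: complex)"
proof (induction m arbitrary: n)
  case 0
  show ?case
  proof (cases n)
    case (Suc n')
    then show ?thesis
      using choose_alternating_sum[of n, where ?'a = complex] by (simp add: mult.commute)
  qed simp
next
  case (Suc m)
  show ?case
  proof (cases n)
    case (Suc n')
    let ?g = "\<lambda>n k. of_nat (n choose k) * (- 1) ^ k * of_nat k ^ m :: complex"
    have step: "of_nat (n choose k) * (- 1) ^ k * of_nat k ^ Suc m =
        of_nat n * (?g n k - ?g n' k)" for k
    proof (cases k)
      case (Suc k')
      have "k * (n choose k) = n * (n' choose k')"
        unfolding Suc \<open>n = Suc n'\<close> by (rule Suc_times_binomial_eq[symmetric, simplified mult.commute[of "_ choose _"]])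
      moreover have "n choose k = (n' choose k') + (n' choose k)"
        unfolding Suc \<open>n = Suc n'\<close> by simp
      ultimately have e: "of_nat k * of_nat (n choose k) =
          (of_nat n * (of_nat (n choose k) - of_nat (n' choose k)) :: complex)"
        by (metis add_diff_cancel_right' of_nat_add of_nat_mult)
      have "of_nat (n choose k) * (- 1) ^ k * of_nat k ^ Suc m =
          (of_nat k * of_nat (n choose k)) * ((- 1) ^ k * of_nat k ^ m :: complex)"
        by simp
      also have "\<dots> = of_nat n * (?g n k - ?g n' k)"
        unfolding e by (simp add: algebra_simps)
      finally show ?thesis .
    qed simp
    have "(\<Sum>k\<le>n. ?g n' k) = (\<Sum>k\<le>n'. ?g n' k)"
      by (simp add: Suc)
    then have "(\<Sum>k\<le>n. of_nat (n choose k) * (- 1) ^ k * of_nat k ^ Suc m) =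
        of_nat n * ((\<Sum>k\<le>n. ?g n k) - (\<Sum>k\<le>n'. ?g n' k))"
      by (simp only: step sum_distrib_left[symmetric] sum_subtractf)
    also have "\<dots> = (- 1) ^ n * fact n * of_nat (Stirling (Suc m) n)"
      by (simp only: Suc.IH) (simp add: \<open>n = Suc n'\<close> algebra_simps)
    finally show ?thesis .
  qed simp
qed

lemma Stirling_explicit:
  "of_nat (Stirling m n) =
     ((- 1) ^ n / fact n * (\<Sum>k\<le>n. of_nat (n choose k) * (- 1) ^ k * of_nat k ^ m) :: complex)"
  by (simp add: alternating_sum_Stirling flip: power_mult_distrib)

lemma at_zmult_nth: "at_zmult f k $ m = fps_const (f $ m * of_nat k ^ m)"
proof -
  have "of_nat k = (fps_const (of_nat k) :: xzseries)"
    by (simp only: fps_of_nat)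
  then show ?thesis
    unfolding at_zmult_def zvar_def
    by (simp only: fps_compose_linear) (simp add: mult.commute flip: fps_of_nat)
qed

lemma xgeo_mult: "(1 - xvar) * xgeo = 1"
proof -
  have "(1 - fps_X) * (1 / (1 - fps_X)) = (1 :: complex fps)"
    by (simp add: fps_divide_unit inverse_mult_eq_1')
  then show ?thesis
    by (simp add: xgeo_def xvar_def flip: fps_const_1_eq_1)
qed

lemma xfrac_eq: "xfrac = xvar * xgeo"
  by (simp add: xfrac_def xgeo_def xvar_def fps_divide_unit)

lemma xz_summable_xpower: "xz_summable (\<lambda>n. G n * xvar ^ n)"
  unfolding xz_summable_def
proof (intro allI)
  fix i j
  have "(G n * xvar ^ n) $ i $ j = 0" if "n > j" for n
    using that by (simp add: xvar_def fps_const_power fps_X_power_mult_right_nth)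
  then show "finite {n. (G n * xvar ^ n) $ i $ j \<noteq> 0}"
    by (intro finite_subset[OF _ finite_atMost[of j]]) (auto simp: not_less[symmetric])
qed

lemma xz_summable_zpower: "xz_summable (\<lambda>m. xz_const (c m) * zvar ^ m * G m)"
  unfolding xz_summable_def
proof (intro allI)
  fix i j
  have "(xz_const (c m) * zvar ^ m * G m) $ i $ j = 0" if "m > i" for m
    using that by (simp add: zvar_def mult.assoc fps_X_power_mult_nth)
  then show "finite {m. (xz_const (c m) * zvar ^ m * G m) $ i $ j \<noteq> 0}"
    by (intro finite_subset[OF _ finite_atMost[of i]]) (auto simp: not_less[symmetric])
qed

lemma xz_summable_families:
  "xz_summable (\<lambda>n. xz_const (c n) * xvar ^ n * G n)"
  "xz_summable (\<lambda>n. xz_const (c n) * (- xvar) ^ n * G n)"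
  "xz_summable (\<lambda>n. xvar ^ n * G n)"
  "xz_summable (\<lambda>n. (- 1) ^ n * G n * xfrac ^ n)"
  using xz_summable_xpower[of "\<lambda>n. xz_const (c n) * G n"]
    xz_summable_xpower[of "\<lambda>n. xz_const (c n) * (- 1) ^ n * G n"]
    xz_summable_xpower[of G]
    xz_summable_xpower[of "\<lambda>n. (- 1) ^ n * G n * xgeo ^ n"]
  by (simp_all add: xfrac_eq power_mult_distrib power_minus[of xvar] mult_ac)

end

theory Submission
  imports Defs
begin

text \<open>
  Let \<open>\<sigma>\<close> be the substitution \<open>x \<mapsto> - x\<close> in the exponential and \<open>x \<mapsto> - x / (1 - x)\<close> in the
  geometric case.  Both are involutions, so (ES) and (GS) are equivalent to their images under
  \<open>\<sigma>\<close>.  Since \<open>\<sigma>\<close> maps \<open>1 - x\<close> to \<open>1 / (1 - x)\<close> and \<open>x / (1 - x)\<close> to \<open>- x\<close> in the geometric case,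
  the image says that the left-hand side of (EE) or (EG) equals the right-hand side of (BE) or (BG).
  Hence each triple consists of the three pairwise equalities between three series.
\<close>

text \<open>A second composition with \<open>g\<close> undoes the first. The vanishing constant term
  of \<open>g\<close> makes composition associative.\<close>

lemma fps_compose_involution_eq_iff:
  fixes F G g :: "'a::idom fps"
  assumes "g oo g = fps_X" "g $ 0 = 0"
  shows "F oo g = G oo g \<longleftrightarrow> F = G"
proof
  assume "F oo g = G oo g"
  then have "(F oo g) oo g = (G oo g) oo g"
    by simp
  then show "F = G"
    by (simp add: assms flip: fps_compose_assoc)
qed simp

text \<open>Serves to carry e^(-x) or 1 - x, the image of the prefactor under the substitution, to
  the other side as e^x or 1 / (1 - x).\<close>

lemma eq_mult_iff_inverse_mult_eq:
  fixes a b u v :: "'a::comm_monoid_mult"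
  assumes "a * b = 1"
  shows "u = b * v \<longleftrightarrow> a * u = v"
proof
  assume "u = b * v"
  then have "a * u = (a * b) * v"
    by (simp only: mult.assoc)
  then show "a * u = v"
    by (simp add: assms)
next
  assume "a * u = v"
  then have "b * v = (a * b) * u"
    by (simp only: mult_ac flip: \<open>a * u = v\<close>)
  then show "u = b * v"
    by (simp add: assms)
qed

lemma poly_exp_poly: "poly (exp_poly m) y = (\<Sum>n\<le>m. of_nat (Stirling m n) * y ^ n)"
  by (simp add: exp_poly_def poly_sum poly_monom)

lemma poly_geo_poly: "poly (geo_poly m) y = (\<Sum>n\<le>m. of_nat (Stirling m n * fact n) * y ^ n)"
  by (simp add: geo_poly_def poly_sum poly_monom)

text \<open>Since \<open>fps_const\<close> is a ring homomorphism, evaluating the polynomials at a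
  series free of z reduces to an evaluation among series in x.\<close>

lemma fps_const_sum_of_nat_power:
  "(\<Sum>n\<le>m. of_nat (c n) * fps_const y ^ n) =
     fps_const (\<Sum>n\<le>m. of_nat (c n) * y ^ n :: 'a::comm_semiring_1)"
  by (induction m) (simp_all flip: fps_of_nat)

lemma fps_compose_sum_of_nat_power:
  fixes w y :: "'a::idom fps"
  assumes "y $ 0 = 0"
  shows "(\<Sum>n\<le>m. of_nat (c n) * w ^ n) oo y = (\<Sum>n\<le>m. of_nat (c n) * (w oo y) ^ n)"
  using assms
  by (simp add: fps_compose_sum_distrib fps_compose_mult_distrib fps_compose_power
      flip: fps_of_nat)

text \<open>Only the member m = i contributes to the power i of z.\<close>

lemma xz_suminf_zpower_nth:
  "xz_suminf (\<lambda>m. xz_const (c m) * zvar ^ m * of_xseries (G m)) $ i = fps_const (c i) * G i"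
proof (rule fps_ext)
  fix j
  let ?t = "\<lambda>m. (xz_const (c m) * zvar ^ m * of_xseries (G m)) $ i $ j"
  have t: "?t m = (if m = i then c i * G i $ j else 0)" for m
    by (simp add: zvar_def)
  have "(\<Sum>m | ?t m \<noteq> 0. ?t m) = (\<Sum>m\<in>{i}. ?t m)"
    unfolding t by (rule sum.mono_neutral_left) auto
  also have "\<dots> = (fps_const (c i) * G i) $ j"
    unfolding t by simp
  finally show "xz_suminf (\<lambda>m. xz_const (c m) * zvar ^ m * of_xseries (G m)) $ i $ j =
      (fps_const (c i) * G i) $ j"
    by (simp only: xz_suminf_def fps_nth_Abs_fps)
qed

text \<open>The coefficients of f(zn) in z are constants, so at a fixed power of z the sum is a
  power series in \<open>y\<close> with constant coefficients, that is, a composition.\<close>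

lemma xz_suminf_at_zmult_nth:
  assumes "y $ 0 = 0"
  shows "xz_suminf (\<lambda>n. xz_const (c n) * of_xseries y ^ n * at_zmult f n) $ i =
    Abs_fps (\<lambda>n. c n * (f $ i * of_nat n ^ i)) oo y"
proof (rule fps_ext)
  fix j
  let ?t = "\<lambda>n. (xz_const (c n) * of_xseries y ^ n * at_zmult f n) $ i $ j"
  have t: "?t n = c n * (f $ i * of_nat n ^ i) * y ^ n $ j" for n
    by (simp add: at_zmult_nth mult_ac)
  have zero: "y ^ n $ j = 0" if "j < n" for n
    using startsby_zero_power_prefix[OF assms] that by blast
  \<comment> \<open>The support lies in {0..j} because \<open>y ^ n\<close> has order at least n;
    this is the range of summation in \<open>fps_compose_nth\<close>.\<close>
  have "(\<Sum>n | ?t n \<noteq> 0. ?t n) = (\<Sum>n\<in>{0..j}. ?t n)"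
    unfolding t by (rule sum.mono_neutral_left) (use zero in \<open>auto simp: not_less[symmetric]\<close>)
  then show "xz_suminf (\<lambda>n. xz_const (c n) * of_xseries y ^ n * at_zmult f n) $ i $ j =
      (Abs_fps (\<lambda>n. c n * (f $ i * of_nat n ^ i)) oo y) $ j"
    by (simp only: xz_suminf_def t fps_nth_Abs_fps fps_compose_nth)
qed

text \<open>Comparing coefficients of z leaves one identity in x alone for each i, so the
  substitution can be made in \<open>complex fps\<close>.\<close>

lemma ES_iff:
  "ES f \<longleftrightarrow>
     xexp * xz_suminf (\<lambda>n. xz_const (1 / fact n) * (- xvar) ^ n * at_zmult f n)
     = xz_suminf (\<lambda>m. xz_const (f $ m) * zvar ^ m * poly (exp_poly m) (- xvar))"
proof -
  let ?A = "\<lambda>i. Abs_fps (\<lambda>n. 1 / fact n * (f $ i * of_nat n ^ i))"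
  let ?P = "\<lambda>i y. fps_const (f $ i) * poly (exp_poly i) y :: complex fps"
  let ?E = "fps_exp 1 :: complex fps"
  have neg: "- xvar = of_xseries (- fps_X)"
    by (simp add: xvar_def)
  have P: "poly (exp_poly m) (of_xseries y) = of_xseries (poly (exp_poly m) y)" for m y
    unfolding poly_exp_poly by (rule fps_const_sum_of_nat_power)
  have A: "xz_suminf (\<lambda>n. xz_const (1 / fact n) * of_xseries y ^ n * at_zmult f n) $ i = ?A i oo y"
    if "y $ 0 = 0" for y i
    by (rule xz_suminf_at_zmult_nth[OF that])
  have A1: "xz_suminf (\<lambda>n. xz_const (1 / fact n) * xvar ^ n * at_zmult f n) $ i = ?A i" for i
    using A[of fps_X i] by (simp add: xvar_def)
  have A2: "xz_suminf (\<lambda>n. xz_const (1 / fact n) * (- xvar) ^ n * at_zmult f n) $ i =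
      ?A i oo - fps_X" for i
    unfolding neg by (rule A) simp
  have P1: "poly (exp_poly m) xvar = of_xseries (poly (exp_poly m) fps_X)"
    and P2: "poly (exp_poly m) (- xvar) = of_xseries (poly (exp_poly m) (- fps_X))" for m
    by (simp_all only: neg P) (simp only: xvar_def P)
  have inv: "(- fps_X) oo (- fps_X) = (fps_X :: complex fps)"
    by (simp add: fps_compose_uminus)
  have exp_neg: "?E oo - fps_X = fps_exp (- 1)"
    using fps_exp_compose_linear[of 1 "- 1"] by simp
  have exp_cancel: "?E * fps_exp (- 1) = 1"
    by (simp flip: fps_exp_add_mult)
  have "ES f \<longleftrightarrow> (\<forall>i. ?A i = ?E * ?P i fps_X)"
    unfolding ES_def P1
    by (subst fps_eq_iff) (simp only: xexp_def A1 xz_suminf_zpower_nth fps_mult_left_const_nth)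
  also have "\<dots> \<longleftrightarrow> (\<forall>i. ?A i oo (- fps_X) = (?E * ?P i fps_X) oo (- fps_X))"
    by (simp add: fps_compose_involution_eq_iff[OF inv])
  also have "\<dots> \<longleftrightarrow> (\<forall>i. ?A i oo (- fps_X) = fps_exp (- 1) * ?P i (- fps_X))"
    by (simp add: fps_compose_mult_distrib exp_neg poly_exp_poly fps_compose_sum_of_nat_power)
  also have "\<dots> \<longleftrightarrow> (\<forall>i. ?E * (?A i oo (- fps_X)) = ?P i (- fps_X))"
    by (simp only: eq_mult_iff_inverse_mult_eq[OF exp_cancel])
  also have "\<dots> \<longleftrightarrow>
     xexp * xz_suminf (\<lambda>n. xz_const (1 / fact n) * (- xvar) ^ n * at_zmult f n)
     = xz_suminf (\<lambda>m. xz_const (f $ m) * zvar ^ m * poly (exp_poly m) (- xvar))"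
    unfolding P2
    by (subst fps_eq_iff) (simp only: xexp_def A2 xz_suminf_zpower_nth fps_mult_left_const_nth)
  finally show ?thesis .
qed

lemma GS_iff:
  "GS f \<longleftrightarrow>
     xgeo * xz_suminf (\<lambda>n. (- 1) ^ n * at_zmult f n * xfrac ^ n)
     = xz_suminf (\<lambda>m. xz_const (f $ m) * zvar ^ m * poly (geo_poly m) (- xvar))"
proof -
  \<comment> \<open>The factor 1 stands for the weight \<open>c n\<close>, which is 1 / n! in the
    exponential case.\<close>
  let ?A = "\<lambda>i. Abs_fps (\<lambda>n. 1 * (f $ i * of_nat n ^ i))"
  let ?P = "\<lambda>i y. fps_const (f $ i) * poly (geo_poly i) y :: complex fps"
  define g :: "complex fps" where "g = 1 / (1 - fps_X)"
  define s where "s = - (fps_X * g)"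
  have g: "(1 - fps_X) * g = 1"
    by (simp add: g_def fps_divide_unit inverse_mult_eq_1')
  then have g': "g * (1 - fps_X) = 1"
    by (simp only: mult.commute)
  have s0: "s $ 0 = 0"
    by (simp add: s_def)
  have frac: "fps_X / (1 - fps_X) = fps_X * g"
    by (simp add: g_def fps_divide_unit)
  \<comment> \<open>Substituting \<open>s\<close> into (1 - x) g = 1 shows that
    \<open>g oo s\<close> is the inverse of 1 - s. As 1 - s = 1 + x g = g, it equals 1 - x.\<close>
  have "((1 - fps_X) * g) oo s = 1"
    by (simp add: g)
  then have "(1 - s) * (g oo s) = 1"
    using s0 by (simp add: fps_compose_mult_distrib fps_compose_sub_distrib)
  moreover have "1 - s = g"
    using g by (simp add: s_def algebra_simps)
  ultimately have gs: "g oo s = 1 - fps_X"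
    using eq_mult_iff_inverse_mult_eq[OF g', of "g oo s" 1] by simp
  \<comment> \<open>The composition is s (1 - x) = - x g (1 - x) = - x.\<close>
  have Xgs: "(fps_X * g) oo s = - fps_X"
    using s0 g by (simp add: fps_compose_mult_distrib gs) (simp add: s_def mult_ac)
  then have inv: "s oo s = fps_X"
    by (metis add.inverse_inverse fps_compose_uminus s_def)
  have xfrac: "xfrac = of_xseries (fps_X * g)"
    by (simp add: xfrac_def frac)
  have neg: "- xvar = of_xseries (- fps_X)"
    by (simp add: xvar_def)
  have P: "poly (geo_poly m) (of_xseries y) = of_xseries (poly (geo_poly m) y)" for m y
    unfolding poly_geo_poly by (rule fps_const_sum_of_nat_power)
  have A: "xz_suminf (\<lambda>n. xz_const 1 * of_xseries y ^ n * at_zmult f n) $ i = ?A i oo y"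
    if "y $ 0 = 0" for y i
    by (rule xz_suminf_at_zmult_nth[OF that])
  have A1: "xz_suminf (\<lambda>n. xvar ^ n * at_zmult f n) $ i = ?A i" for i
    using A[of fps_X i] by (simp add: xvar_def)
  \<comment> \<open>The alternating sign is absorbed into the power, which makes the left-hand side
    of (EG) a composition with \<open>s\<close>.\<close>
  have "(- 1) ^ n * at_zmult f n * xfrac ^ n = xz_const 1 * of_xseries s ^ n * at_zmult f n" for n
  proof -
    have "of_xseries s = - xfrac"
      by (simp add: xfrac s_def)
    then show ?thesis
      by (simp add: power_minus[of xfrac] mult_ac)
  qed
  then have A2: "xz_suminf (\<lambda>n. (- 1) ^ n * at_zmult f n * xfrac ^ n) $ i = ?A i oo s" for i
    by (simp only: A[OF s0])
  have "GS f \<longleftrightarrow> (\<forall>i. ?A i = g * ?P i (fps_X * g))"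
    unfolding GS_def xfrac P
    by (subst fps_eq_iff) (simp add: A1 xz_suminf_zpower_nth xgeo_def flip: g_def)
  also have "\<dots> \<longleftrightarrow> (\<forall>i. ?A i oo s = (g * ?P i (fps_X * g)) oo s)"
    by (simp add: fps_compose_involution_eq_iff[OF inv s0])
  \<comment> \<open>Distributing the composition leaves \<open>(fps_X oo s) * (1 - fps_X)\<close> as
    the argument of the polynomial, so \<open>Xgs\<close> is unfolded to match this form.\<close>
  also have "\<dots> \<longleftrightarrow> (\<forall>i. ?A i oo s = (1 - fps_X) * ?P i (- fps_X))"
    by (simp only: fps_compose_mult_distrib[OF s0] gs poly_geo_poly
        fps_compose_sum_of_nat_power[OF s0] Xgs[unfolded fps_compose_mult_distrib[OF s0] gs]
        fps_const_compose)
  also have "\<dots> \<longleftrightarrow> (\<forall>i. g * (?A i oo s) = ?P i (- fps_X))"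
    by (simp only: eq_mult_iff_inverse_mult_eq[OF g'])
  also have "\<dots> \<longleftrightarrow>
     xgeo * xz_suminf (\<lambda>n. (- 1) ^ n * at_zmult f n * xfrac ^ n)
     = xz_suminf (\<lambda>m. xz_const (f $ m) * zvar ^ m * poly (geo_poly m) (- xvar))"
    unfolding neg P
    by (subst fps_eq_iff) (simp add: A2 xz_suminf_zpower_nth xgeo_def flip: g_def)
  finally show ?thesis .
qed

theorem theorem3:
  fixes f :: "complex fps"
  shows "((BE f \<and> ES f \<longrightarrow> EE f) \<and> (BE f \<and> EE f \<longrightarrow> ES f) \<and> (ES f \<and> EE f \<longrightarrow> BE f))
       \<and> ((BG f \<and> GS f \<longrightarrow> EG f) \<and> (BG f \<and> EG f \<longrightarrow> GS f) \<and> (GS f \<and> EG f \<longrightarrow> BG f))"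
  unfolding ES_iff GS_iff BE_def EE_def BG_def EG_def by auto

end
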